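(* Let $k\ge 2$ and let $H$ be a finite simple $k$-uniform hypergraph with $m=|E(H)|\ge 1$. (i) If $K\colon[0,1]^k\to[0,1]$ is a symmetric $k$-uniform hyperkernel and for every $e\in E(H)$ the edge-rooted density $r_e^K$ is almost everywhere equal to a constant, then either $t(H,K)=0$ or $K=p$ almost everywhere, where $p:=t(H,K)^{1/m}$. (ii) If $W\colon[0,1]^{\mathcal{A}_k}\to[0,1]$ is an $S_k$-invariant $k$-uniform hypergraphon and for every $e\in E(H)$ the full-edge-rooted density $r_e^W$ is almost everywhere equal to a constant, then either $t(H,W)=0$ or $W=p$ almost everywhere, where $p:=t(H,W)^{1/m}$.
   Context: All integrals are with respect to Lebesgue measure. A finite simple $k$-uniform hypergraph $H=(V,E)$ has a finite vertex set $V$ and $E$ is a set of $k$-element subsets of $V$. Hyperkernels. A symmetric $k$-uniform hyperkernel is a measurable function $K\colon[0,1]^k\to[0,1]$ invariant under permutations of its coordinates. For $f\in E$ write $\mathbf{x}_f=(x_v)_{v\in f}$ (in any order). Define $$t(H,K):=\int_{[0,1]^V}\prod_{f\in E}K(\mathbf{x}_f)\prod_{v\in V}dx_v,\qquad r_e^K(\mathbf{x}_e):=\int_{[0,1]^{V\setminus e}}\prod_{f\in E}K(\mathbf{z}_f)\prod_{v\in V\setminus e}dz_v,$$ where in the second formula $z_v=x_v$ for $v\in e$; $r_e^K$ is a function on $[0,1]^k$. Hypergraphons (dissociated Aldous–Hoover representation, with no global coordinate and no coordinate for the full edge). Let $\mathcal{A}_k:=\{A:\emptyset\ne A\subsetneq[k]\}$.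 A $k$-uniform hypergraphon is a measurable function $W\colon[0,1]^{\mathcal{A}_k}\to[0,1]$ that is $S_k$-invariant: for $\pi\in S_k$ and $\mathbf{x}=(x_A)_{A\in\mathcal{A}_k}$ put $(\pi\cdot\mathbf{x})_A:=x_{\pi^{-1}A}$; then $W(\pi\cdot\mathbf{x})=W(\mathbf{x})$ for every $\pi\in S_k$ and almost every $\mathbf{x}$. Let $X_B$ be independent uniform $[0,1]$ random variables, one for each nonempty $B\subseteq V$ with $|B|<k$. For each edge $e\in E$ choose a bijection $\eta_e\colon[k]\to e$, write $\eta_e(A)=\{\eta_e(i):i\in A\}$ and $X_e^\circ:=(X_{\eta_e(A)})_{A\in\mathcal{A}_k}$ (by invariance, the choice of orderings is immaterial in what follows). Define $$t(H,W):=\mathbb{E}\prod_{e\in E}W(X_e^\circ),$$ and define the full-edge-rooted density of $H$ in $W$ at $e\in E$ as the function on $[0,1]^{\mathcal{A}_k}$ $$r_e^W(\mathbf{x}):=\mathbb{E}\Big[\prod_{f\in E}W(X_f^\circ)\ \Big|\ X_{\eta_e(A)}=x_A\text{ for every }A\in\mathcal{A}_k\Big],$$ meaning the version obtained by fixing the listed coordinates and integrating out all the remaining independent coordinates. *)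

theory Defs
  imports "HOL-Probability.Probability" "HOL-Combinatorics.Permutations"
begin

text \<open>Lebesgue measure on \<open>[0,1]\<^sup>I\<close>.  Completing the product of the Borel measures makes
  ``measurable'' mean Lebesgue measurable, which includes the Borel case.\<close>

definition cube :: "'i set \<Rightarrow> ('i \<Rightarrow> real) measure" where
  "cube I = completion (\<Pi>\<^sub>M i\<in>I. restrict_space lborel {0..1})"

definition uniform_hypergraph :: "nat \<Rightarrow> 'v set \<Rightarrow> 'v set set \<Rightarrow> bool" where
  "uniform_hypergraph k V E \<longleftrightarrow> finite V \<and> (\<forall>e\<in>E. e \<subseteq> V \<and> card e = k)"

text \<open>In what follows \<open>\<eta> e\<close> is an ordering \<open>{1..k} \<rightarrow> e\<close> of the edge \<open>e\<close>, used to read off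
  coordinates in \<open>[0,1]\<^sup>k\<close> from coordinates indexed by the elements (or subsets) of \<open>e\<close>.\<close>

definition edge_orderings :: "nat \<Rightarrow> 'v set set \<Rightarrow> ('v set \<Rightarrow> nat \<Rightarrow> 'v) \<Rightarrow> bool" where
  "edge_orderings k E \<eta> \<longleftrightarrow> (\<forall>e\<in>E. bij_betw (\<eta> e) {1..k} e)"


subsection \<open>Hyperkernels\<close>

definition hyperkernel :: "nat \<Rightarrow> ((nat \<Rightarrow> real) \<Rightarrow> real) \<Rightarrow> bool" where
  "hyperkernel k K \<longleftrightarrow>
     K \<in> borel_measurable (cube {1..k}) \<and>
     (\<forall>x\<in>space (cube {1..k}). 0 \<le> K x \<and> K x \<le> 1) \<and>
     (\<forall>\<pi>. \<pi> permutes {1..k} \<longrightarrow>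
        (\<forall>x\<in>space (cube {1..k}). K (\<lambda>i\<in>{1..k}. x (\<pi> i)) = K x))"

definition kernel_integrand ::
  "nat \<Rightarrow> 'v set set \<Rightarrow> ('v set \<Rightarrow> nat \<Rightarrow> 'v) \<Rightarrow> ((nat \<Rightarrow> real) \<Rightarrow> real) \<Rightarrow> ('v \<Rightarrow> real) \<Rightarrow> real" where
  "kernel_integrand k E \<eta> K z = (\<Prod>f\<in>E. K (\<lambda>i\<in>{1..k}. z (\<eta> f i)))"

definition kernel_density ::
  "nat \<Rightarrow> 'v set \<Rightarrow> 'v set set \<Rightarrow> ('v set \<Rightarrow> nat \<Rightarrow> 'v) \<Rightarrow> ((nat \<Rightarrow> real) \<Rightarrow> real) \<Rightarrow> real" where
  "kernel_density k V E \<eta> K = (\<integral>z. kernel_integrand k E \<eta> K z \<partial>cube V)"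

definition kernel_rooted_density ::
  "nat \<Rightarrow> 'v set \<Rightarrow> 'v set set \<Rightarrow> ('v set \<Rightarrow> nat \<Rightarrow> 'v) \<Rightarrow> ((nat \<Rightarrow> real) \<Rightarrow> real) \<Rightarrow>
    'v set \<Rightarrow> (nat \<Rightarrow> real) \<Rightarrow> real" where
  "kernel_rooted_density k V E \<eta> K e x =
     (\<integral>z. kernel_integrand k E \<eta> K
            (merge e (V - e) (\<lambda>v\<in>e. x (inv_into {1..k} (\<eta> e) v), z)) \<partial>cube (V - e))"


subsection \<open>Hypergraphons\<close>

definition proper_faces :: "'a set \<Rightarrow> 'a set set" where
  "proper_faces S = {A. A \<noteq> {} \<and> A \<subset> S}"

definition hypergraphon :: "nat \<Rightarrow> ((nat set \<Rightarrow> real) \<Rightarrow> real) \<Rightarrow> bool" where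
  "hypergraphon k W \<longleftrightarrow>
     W \<in> borel_measurable (cube (proper_faces {1..k})) \<and>
     (\<forall>x\<in>space (cube (proper_faces {1..k})). 0 \<le> W x \<and> W x \<le> 1) \<and>
     (\<forall>\<pi>. \<pi> permutes {1..k} \<longrightarrow>
        (AE x in cube (proper_faces {1..k}).
           W (\<lambda>A\<in>proper_faces {1..k}. x (inv \<pi> ` A)) = W x))"

text \<open>The independent uniform variables \<open>X\<^sub>B\<close> are realised as the coordinates of
  \<open>cube (small_sets k V)\<close>, so expectations are integrals over this cube.\<close>

definition small_sets :: "nat \<Rightarrow> 'v set \<Rightarrow> 'v set set" where
  "small_sets k V = {B. B \<noteq> {} \<and> B \<subseteq> V \<and> card B < k}"

definition graphon_integrand ::
  "nat \<Rightarrow> 'v set set \<Rightarrow> ('v set \<Rightarrow> nat \<Rightarrow> 'v) \<Rightarrow> ((nat set \<Rightarrow> real) \<Rightarrow> real) \<Rightarrow>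
    ('v set \<Rightarrow> real) \<Rightarrow> real" where
  "graphon_integrand k E \<eta> W X =
     (\<Prod>f\<in>E. W (\<lambda>A\<in>proper_faces {1..k}. X (\<eta> f ` A)))"

definition graphon_density ::
  "nat \<Rightarrow> 'v set \<Rightarrow> 'v set set \<Rightarrow> ('v set \<Rightarrow> nat \<Rightarrow> 'v) \<Rightarrow> ((nat set \<Rightarrow> real) \<Rightarrow> real) \<Rightarrow> real" where
  "graphon_density k V E \<eta> W = (\<integral>X. graphon_integrand k E \<eta> W X \<partial>cube (small_sets k V))"

text \<open>The fixed coordinates are \<open>X\<^bsub>\<eta> e ` A\<^esub> = x\<^sub>A\<close>; for \<open>B\<close> a proper face of \<open>e\<close> the
  corresponding \<open>A\<close> is \<open>inv_into {1..k} (\<eta> e) ` B\<close>.\<close>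

definition graphon_rooted_density ::
  "nat \<Rightarrow> 'v set \<Rightarrow> 'v set set \<Rightarrow> ('v set \<Rightarrow> nat \<Rightarrow> 'v) \<Rightarrow> ((nat set \<Rightarrow> real) \<Rightarrow> real) \<Rightarrow>
    'v set \<Rightarrow> (nat set \<Rightarrow> real) \<Rightarrow> real" where
  "graphon_rooted_density k V E \<eta> W e x =
     (\<integral>z. graphon_integrand k E \<eta> W
            (merge (proper_faces e) (small_sets k V - proper_faces e)
              (\<lambda>B\<in>proper_faces e. x (inv_into {1..k} (\<eta> e) ` B), z))
        \<partial>cube (small_sets k V - proper_faces e))"

end

theory Submission imports Defs begin

text \<open>Both parts are instances of one statement about independent, identically distributed variables
\<open>(X\<^sub>v)\<^bsub>v \<in> I\<^esub>\<close>.  A kernel \<open>K\<close> in variables indexed by \<open>N\<close> is evaluated along injections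
\<open>\<phi>\<^sub>e : N \<rightarrow> I\<close>, one for each \<open>e \<in> E\<close>; write \<open>K\<^sub>e\<close> for the resulting function of \<open>X\<close> and
\<open>\<Phi> = \<Prod>\<^sub>e K\<^sub>e\<close>.  For hyperkernels \<open>I\<close> is the vertex set and \<open>N = {1..k}\<close>; for hypergraphons \<open>I\<close>
consists of the small vertex sets and \<open>N\<close> of the proper faces of \<open>{1..k}\<close>.

Suppose that every rooted density is constant.  Each constant is then \<open>t = E \<Phi>\<close>, because the
rooted density averages to \<open>t\<close>; assume \<open>t > 0\<close>.  The factor \<open>K\<^sub>e\<close> bounds the rooted density at
\<open>e\<close> from above, so \<open>K \<ge> t\<close> almost everywhere and \<open>l = ln K\<close> is bounded.  Constancy of
the rooted density at \<open>e\<close> says that the probability density \<open>\<Phi> / t\<close> does not change the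
distribution of the variables seen by \<open>e\<close>, hence \<open>E[\<Phi> l\<^sub>e] = t E[l\<^sub>e]\<close>.  Summing over \<open>e\<close> gives
\<open>E[\<Phi> ln \<Phi>] = t E[ln \<Phi>]\<close>, that is, \<open>E[(\<Phi> - t)(ln \<Phi> - ln t)] = 0\<close>.  The integrand is nonnegative
and vanishes only where \<open>\<Phi> = t\<close>, so \<open>\<Phi>\<close> is almost surely constant.  (The expectation is, up
to the factor \<open>t\<close>, the sum of the two relative entropies between the laws with densities \<open>1\<close>
and \<open>\<Phi> / t\<close>.)

Let \<open>u = l - E l\<close>.  Now \<open>\<Sum>\<^sub>e u\<^sub>e = 0\<close> almost surely; multiplying by \<open>u\<^sub>e\<close> for a
fixed \<open>e\<close> gives \<open>\<Sum>\<^sub>f E[u\<^sub>e u\<^sub>f] = 0\<close>.  Each summand is nonnegative: given the variables shared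
by \<open>e\<close> and \<open>f\<close>, the factors are independent, and by the symmetry of \<open>u\<close> they have the same
conditional expectation, so that \<open>E[u\<^sub>e u\<^sub>f]\<close> is the second moment of this conditional
expectation (\<open>correlation_nonneg\<close>).  Hence the summand \<open>f = e\<close> vanishes, which says that
\<open>u = 0\<close> (\<open>copies_sum_zero\<close>) and that \<open>K\<close> is constant (\<open>rigidity\<close>).  Lebesgue measurable kernels are handled
by passing to a Borel measurable version (\<open>rigidity_completion\<close>).\<close>

section \<open>Subfamilies of independent, identically distributed variables\<close>

abbreviation iid :: "'i set \<Rightarrow> 'a measure \<Rightarrow> ('i \<Rightarrow> 'a) measure" where
  "iid I M \<equiv> \<Pi>\<^sub>M i\<in>I. M"

definition pull :: "'n set \<Rightarrow> ('n \<Rightarrow> 'i) \<Rightarrow> ('i \<Rightarrow> 'a) \<Rightarrow> 'n \<Rightarrow> 'a" where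
  "pull N \<phi> X = (\<lambda>i\<in>N. X (\<phi> i))"

text \<open>The configuration on \<open>I\<close> whose coordinates in the image of \<open>\<phi>\<close> are prescribed by \<open>x\<close>, which is
indexed by \<open>N\<close>, and whose remaining coordinates are those of \<open>z\<close>.\<close>

definition glue :: "'i set \<Rightarrow> 'n set \<Rightarrow> ('n \<Rightarrow> 'i) \<Rightarrow> ('n \<Rightarrow> 'a) \<Rightarrow> ('i \<Rightarrow> 'a) \<Rightarrow> 'i \<Rightarrow> 'a" where
  "glue I N \<phi> x z = merge (\<phi> ` N) (I - \<phi> ` N) (pull (\<phi> ` N) (inv_into N \<phi>) x, z)"

lemma measurable_pull:
  assumes "\<phi> ` N \<subseteq> I"
  shows "pull N \<phi> \<in> iid I M \<rightarrow>\<^sub>M iid N M"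
  using assms unfolding pull_def
  by (intro measurable_restrict measurable_component_singleton) auto

lemma pull_pull: "\<sigma> ` N \<subseteq> N' \<Longrightarrow> pull N \<sigma> (pull N' \<phi> X) = pull N (\<phi> \<circ> \<sigma>) X"
  by (auto simp: pull_def restrict_def fun_eq_iff)

lemma prob_space_iid: "prob_space M \<Longrightarrow> prob_space (iid I M)"
  by (rule prob_space_PiM)

text \<open>Distinct coordinates of an independent, identically distributed family again form such a family; injectivity of \<open>\<phi>\<close> is what makes them distinct.\<close>

lemma distr_pull:
  assumes "prob_space M" "inj_on \<phi> N" "\<phi> ` N \<subseteq> I"
  shows "distr (iid I M) (iid N M) (pull N \<phi>) = iid N M"
  using distr_PiM_reindex[of I "\<lambda>_. M" \<phi> N] assms
  by (simp add: pull_def[abs_def] image_subset_iff_funcset)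

lemma integral_pull:
  fixes h :: "_ \<Rightarrow> real"
  assumes "prob_space M" "inj_on \<phi> N" "\<phi> ` N \<subseteq> I" "h \<in> borel_measurable (iid N M)"
  shows "(\<integral>X. h (pull N \<phi> X) \<partial>iid I M) = (\<integral>x. h x \<partial>iid N M)"
  using integral_distr[OF measurable_pull[OF assms(3)] assms(4)] distr_pull[OF assms(1-3)]
  by simp

lemma AE_pull:
  assumes "prob_space M" "inj_on \<phi> N" "\<phi> ` N \<subseteq> I" "AE x in iid N M. Q x"
  shows "AE X in iid I M. Q (pull N \<phi> X)"
  using assms(4) by (intro AE_distrD[OF measurable_pull[OF assms(3)]]) (simp only: distr_pull[OF assms(1-3)])

lemma integrable_bounded:
  fixes h :: "_ \<Rightarrow> real"
  assumes "prob_space M" "h \<in> borel_measurable M" "\<And>x. \<bar>h x\<bar> \<le> B"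
  shows "integrable M h"
proof -
  interpret prob_space M by fact
  show ?thesis using assms by (intro integrable_const_bound[where B=B]) auto
qed

lemma glue_pull_measurable:
  assumes "\<phi> ` N \<subseteq> I"
  shows "(\<lambda>(x, z). (pull (\<phi> ` N) (inv_into N \<phi>) x, z)) \<in>
    iid N M \<Otimes>\<^sub>M iid (I - \<phi> ` N) M \<rightarrow>\<^sub>M iid (\<phi> ` N) M \<Otimes>\<^sub>M iid (I - \<phi> ` N) M"
proof -
  have [measurable]: "pull (\<phi> ` N) (inv_into N \<phi>) \<in> iid N M \<rightarrow>\<^sub>M iid (\<phi> ` N) M"
    by (rule measurable_pull) (auto intro: inv_into_into)
  show ?thesis by measurable
qed

lemma measurable_glue:
  assumes "\<phi> ` N \<subseteq> I"
  shows "case_prod (glue I N \<phi>) \<in> iid N M \<Otimes>\<^sub>M iid (I - \<phi> ` N) M \<rightarrow>\<^sub>M iid I M"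
proof -
  have "\<phi> ` N \<union> (I - \<phi> ` N) = I" using assms by auto
  then show ?thesis
    using measurable_comp[OF glue_pull_measurable[OF assms] measurable_merge[of "\<phi> ` N" "I - \<phi> ` N"]]
    by (simp add: comp_def glue_def[abs_def] case_prod_unfold)
qed

text \<open>Independence of the coordinates inside and outside the image of \<open>\<phi>\<close>, transported to the index set \<open>N\<close>.\<close>

lemma distr_glue:
  assumes M: "prob_space M" and "finite I" "inj_on \<phi> N" and sub: "\<phi> ` N \<subseteq> I"
  shows "distr (iid N M \<Otimes>\<^sub>M iid (I - \<phi> ` N) M) (iid I M) (case_prod (glue I N \<phi>)) = iid I M"
proof -
  let ?A = "\<phi> ` N" and ?B = "I - \<phi> ` N" and ?r = "pull (\<phi> ` N) (inv_into N \<phi>)"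
  interpret prob_space M by fact
  interpret product_sigma_finite "\<lambda>_. M" by standard
  interpret B: prob_space "iid ?B M" by (rule prob_space_iid) fact
  have AB: "?A \<union> ?B = I" using sub by auto
  have fin: "finite ?A" "finite ?B" using sub \<open>finite I\<close> finite_subset by auto
  have r: "?r \<in> iid N M \<rightarrow>\<^sub>M iid ?A M"
    by (rule measurable_pull) (auto intro: inv_into_into)
  have "distr (iid N M) (iid ?A M) ?r = iid ?A M"
    by (rule distr_pull) (use M in \<open>auto intro: inj_on_inv_into inv_into_into\<close>)
  then have "iid ?A M \<Otimes>\<^sub>M iid ?B M
      = distr (iid N M) (iid ?A M) ?r \<Otimes>\<^sub>M distr (iid ?B M) (iid ?B M) (\<lambda>z. z)"
    by (simp add: distr_id)
  also have "\<dots> = distr (iid N M \<Otimes>\<^sub>M iid ?B M) (iid ?A M \<Otimes>\<^sub>M iid ?B M) (\<lambda>(x, z). (?r x, z))"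
    by (rule pair_measure_distr[OF r]) (simp_all add: B.sigma_finite_measure_axioms distr_id)
  finally have *: "iid ?A M \<Otimes>\<^sub>M iid ?B M = \<dots>" .
  have "iid I M = distr (iid ?A M \<Otimes>\<^sub>M iid ?B M) (iid I M) (merge ?A ?B)"
    using distr_merge[of ?A ?B] fin AB by auto
  also have "\<dots> = distr (iid N M \<Otimes>\<^sub>M iid ?B M) (iid I M) (merge ?A ?B \<circ> (\<lambda>(x, z). (?r x, z)))"
    by (subst *, rule distr_distr)
      (use measurable_merge[of ?A ?B] glue_pull_measurable[OF sub] AB in auto)
  also have "merge ?A ?B \<circ> (\<lambda>(x, z). (?r x, z)) = case_prod (glue I N \<phi>)"
    by (auto simp: glue_def)
  finally show ?thesis by simp
qed

text \<open>A version of the conditional expectation of \<open>\<Phi>\<close> given that the coordinates selected by \<open>\<phi>\<close> are \<open>x\<close>.\<close>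

definition rooted :: "'a measure \<Rightarrow> 'i set \<Rightarrow> 'n set \<Rightarrow> ('n \<Rightarrow> 'i) \<Rightarrow> (('i \<Rightarrow> 'a) \<Rightarrow> real) \<Rightarrow> ('n \<Rightarrow> 'a) \<Rightarrow> real" where
  "rooted M I N \<phi> \<Phi> x = (\<integral>z. \<Phi> (glue I N \<phi> x z) \<partial>iid (I - \<phi> ` N) M)"

lemma integral_rooted:
  assumes M: "prob_space M" and "finite I" "inj_on \<phi> N" and sub: "\<phi> ` N \<subseteq> I"
    and \<Phi>: "\<Phi> \<in> borel_measurable (iid I M)" "\<And>X. \<bar>\<Phi> X\<bar> \<le> B"
  shows "(\<integral>x. rooted M I N \<phi> \<Phi> x \<partial>iid N M) = (\<integral>X. \<Phi> X \<partial>iid I M)"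
    and "rooted M I N \<phi> \<Phi> \<in> borel_measurable (iid N M)"
proof -
  let ?B = "I - \<phi> ` N"
  interpret N: prob_space "iid N M" by (rule prob_space_iid) fact
  interpret B: prob_space "iid ?B M" by (rule prob_space_iid) fact
  interpret pair_prob_space "iid N M" "iid ?B M" ..
  have m: "(\<lambda>(x, z). \<Phi> (glue I N \<phi> x z)) \<in> borel_measurable (iid N M \<Otimes>\<^sub>M iid ?B M)"
    using measurable_comp[OF measurable_glue[OF sub] \<Phi>(1)] by (simp add: comp_def case_prod_unfold)
  have int: "integrable (iid N M \<Otimes>\<^sub>M iid ?B M) (\<lambda>(x, z). \<Phi> (glue I N \<phi> x z))"
    by (rule integrable_bounded[OF _ m, of B]) (auto simp: \<Phi>(2) P.prob_space_axioms)
  have "(\<integral>X. \<Phi> X \<partial>iid I M) = (\<integral>p. \<Phi> (case_prod (glue I N \<phi>) p) \<partial>(iid N M \<Otimes>\<^sub>M iid ?B M))"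
    using integral_distr[OF measurable_glue[OF sub] \<Phi>(1)] distr_glue[OF assms(1-4)] by simp
  also have "\<dots> = (\<integral>x. rooted M I N \<phi> \<Phi> x \<partial>iid N M)"
    using integral_fst[OF int] by (simp add: rooted_def case_prod_unfold)
  finally show "(\<integral>x. rooted M I N \<phi> \<Phi> x \<partial>iid N M) = (\<integral>X. \<Phi> X \<partial>iid I M)" ..
  show "rooted M I N \<phi> \<Phi> \<in> borel_measurable (iid N M)"
    unfolding rooted_def[abs_def] by (rule B.borel_measurable_lebesgue_integral[OF m])
qed

lemma AE_glue:
  assumes M: "prob_space M" and "finite I" "inj_on \<phi> N" and sub: "\<phi> ` N \<subseteq> I"
    and Q: "AE X in iid I M. Q X"
  shows "AE x in iid N M. AE z in iid (I - \<phi> ` N) M. Q (glue I N \<phi> x z)"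
proof -
  interpret N: prob_space "iid N M" by (rule prob_space_iid) fact
  interpret B: prob_space "iid (I - \<phi> ` N) M" by (rule prob_space_iid) fact
  interpret pair_prob_space "iid N M" "iid (I - \<phi> ` N) M" ..
  have "AE p in iid N M \<Otimes>\<^sub>M iid (I - \<phi> ` N) M. Q (case_prod (glue I N \<phi>) p)"
    using Q by (intro AE_distrD[OF measurable_glue[OF sub]]) (simp only: distr_glue[OF assms(1-4)])
  from AE_pair[OF this] show ?thesis by simp
qed

lemma pull_glue:
  assumes "inj_on \<phi> N" "x \<in> space (iid N M)"
  shows "pull N \<phi> (glue I N \<phi> x z) = x"
  using assms by (auto simp: pull_def glue_def merge_def fun_eq_iff space_PiM PiE_def extensional_def)

lemma glue_outside:
  "v \<in> I - \<phi> ` N \<Longrightarrow> glue I N \<phi> x z v = z v"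
  by (auto simp: glue_def merge_def)

lemma glue_inside:
  "inj_on \<phi> N \<Longrightarrow> i \<in> N \<Longrightarrow> glue I N \<phi> x z (\<phi> i) = x i"
  by (auto simp: glue_def merge_def pull_def)

section \<open>Correlation of two overlapping copies\<close>

text \<open>The hypothesis \<open>agree\<close> says that \<open>\<phi>\<close> and \<open>\<psi>\<close> reach a shared coordinate from the same index, so
the two factors depend on the shared coordinates in the same way.  Conditionally on these they are
independent and have a common conditional expectation \<open>w\<close>, and the integral is the second moment
of \<open>w\<close>.  Without \<open>agree\<close> the sign may be negative: for \<open>u (x\<^sub>1, x\<^sub>2) = x\<^sub>1 - x\<^sub>2\<close> and copies
that meet in the first coordinate of one and the second of the other, the correlation is minus the variance of a coordinate.\<close>

lemma correlation_nonneg: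
  fixes u :: "('n \<Rightarrow> 'a) \<Rightarrow> real" and \<phi> \<psi> :: "'n \<Rightarrow> 'i"
  assumes M: "prob_space M" and fin: "finite I" "finite N"
    and \<phi>: "inj_on \<phi> N" "\<phi> ` N \<subseteq> I" and \<psi>: "inj_on \<psi> N" "\<psi> ` N \<subseteq> I"
    and agree: "\<And>i. i \<in> N \<Longrightarrow> \<phi> i \<in> \<psi> ` N \<Longrightarrow> \<psi> i = \<phi> i"
    and u: "u \<in> borel_measurable (iid N M)" "\<And>x. \<bar>u x\<bar> \<le> B"
  shows "0 \<le> (\<integral>X. u (pull N \<phi> X) * u (pull N \<psi> X) \<partial>iid I M)"
proof -
  \<comment> \<open>\<open>C\<close> indexes the shared coordinates and \<open>D\<close> the private ones.\<close>
  define C where "C = {i \<in> N. \<phi> i \<in> \<psi> ` N}"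
  define D where "D = N - C"
  have CD: "C \<union> D = N" "C \<inter> D = {}" "finite C" "finite D" "C \<subseteq> N" "D \<subseteq> N"
    using fin by (auto simp: C_def D_def)
  interpret prob_space M by fact
  interpret product_sigma_finite "\<lambda>_::'n. M" by standard
  interpret C: prob_space "iid C M" by (rule prob_space_iid) fact
  interpret D: prob_space "iid D M" by (rule prob_space_iid) fact
  interpret N: prob_space "iid N M" by (rule prob_space_iid) fact
  have mr: "(\<lambda>p. merge C D (restrict (fst p) C, snd p)) \<in> iid N M \<Otimes>\<^sub>M iid D M \<rightarrow>\<^sub>M iid N M"
  proof -
    have [measurable]: "(\<lambda>x. restrict x C) \<in> iid N M \<rightarrow>\<^sub>M iid C M"
      by (rule measurable_restrict_subset) fact
    have [measurable]: "merge C D \<in> iid C M \<Otimes>\<^sub>M iid D M \<rightarrow>\<^sub>M iid N M"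
      using measurable_merge[of C D "\<lambda>_. M"] CD(1) by simp
    show ?thesis by measurable
  qed
  \<comment> \<open>The restriction to \<open>C\<close> lets \<open>w\<close> be used as a function on the whole of \<open>iid N M\<close>.\<close>
  define w where "w x = (\<integral>y. u (merge C D (restrict x C, y)) \<partial>iid D M)" for x
  have w_meas: "w \<in> borel_measurable (iid N M)"
    unfolding w_def[abs_def]
    using measurable_comp[OF mr u(1)]
    by (intro D.borel_measurable_lebesgue_integral) (simp add: comp_def case_prod_unfold)
  have u_int: "integrable (iid D M) (\<lambda>y. u (merge C D (restrict x C, y)))" if "x \<in> space (iid N M)" for x
  proof (rule integrable_bounded[OF D.prob_space_axioms _ u(2)])
    show "(\<lambda>y. u (merge C D (restrict x C, y))) \<in> borel_measurable (iid D M)"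
      using measurable_comp[OF measurable_Pair1'[OF that] measurable_comp[OF mr u(1)]]
      by (simp add: comp_def)
  qed
  have w_bd: "\<bar>w x\<bar> \<le> B" if "x \<in> space (iid N M)" for x
  proof -
    have "\<bar>w x\<bar> \<le> (\<integral>y. \<bar>u (merge C D (restrict x C, y))\<bar> \<partial>iid D M)"
      unfolding w_def by (rule integral_abs_bound)
    also have "\<dots> \<le> (\<integral>y. B \<partial>iid D M)"
      by (rule integral_mono) (use u_int[OF that] u(2) in auto)
    finally show ?thesis by (simp add: D.prob_space)
  qed
  let ?F = "\<lambda>X. u (pull N \<phi> X) * u (pull N \<psi> X)"
  note [measurable] = measurable_pull[OF \<phi>(2)] measurable_pull[OF \<psi>(2)] u(1)
  have B0: "0 \<le> B" using u(2)[of undefined] by linarith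
  have F: "?F \<in> borel_measurable (iid I M)"
    by measurable
  have F_bd: "\<bar>?F X\<bar> \<le> B * B" for X
    unfolding abs_mult by (intro mult_mono u(2) B0) simp
  \<comment> \<open>Once the coordinates seen by \<open>\<phi>\<close> are fixed, only the private coordinates of the second factor remain random.\<close>
  have rooted: "rooted M I N \<phi> ?F x = u x * w x" if x: "x \<in> space (iid N M)" for x
  proof -
    have D_sub: "\<psi> ` D \<subseteq> I - \<phi> ` N"
    proof safe
      fix i j assume i: "i \<in> D" and j: "j \<in> N" "\<psi> i = \<phi> j"
      have "i \<in> N" using i CD(6) by blast
      have "\<phi> j \<in> \<psi> ` N" unfolding j(2)[symmetric] using \<open>i \<in> N\<close> by (rule imageI)
      with j(1) have "\<psi> j = \<phi> j" "j \<in> C" by (rule agree, simp add: C_def)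
      then have "i = j" using inj_onD[OF \<psi>(1), of i j] j \<open>i \<in> N\<close> by simp
      then show False using i \<open>j \<in> C\<close> by (simp add: D_def)
    qed (use \<psi>(2) CD(6) in blast)
    have "pull N \<psi> (glue I N \<phi> x z) = merge C D (restrict x C, pull D \<psi> z)" for z
    proof
      fix i
      consider "i \<notin> N" | "i \<in> C" | "i \<in> D" using CD by auto
      then show "pull N \<psi> (glue I N \<phi> x z) i = merge C D (restrict x C, pull D \<psi> z) i"
      proof cases
        case 1
        then have "i \<notin> C" "i \<notin> D" using CD(5,6) by blast+
        with 1 show ?thesis by (simp add: pull_def merge_def)
      next
        case 2
        then have "i \<in> N" "\<psi> i = \<phi> i" using agree[of i] unfolding C_def by blast+
        with 2 show ?thesis by (simp add: pull_def merge_def glue_inside[OF \<phi>(1)])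
      next
        case 3
        then have "\<psi> i \<in> I - \<phi> ` N" "i \<in> N" "i \<notin> C" using D_sub CD(2,6) by blast+
        with 3 show ?thesis by (simp add: pull_def merge_def glue_outside)
      qed
    qed
    then have "rooted M I N \<phi> ?F x
        = (\<integral>z. u x * u (merge C D (restrict x C, pull D \<psi> z)) \<partial>iid (I - \<phi> ` N) M)"
      by (simp add: rooted_def pull_glue[OF \<phi>(1) x])
    also have "\<dots> = u x * (\<integral>z. u (merge C D (restrict x C, pull D \<psi> z)) \<partial>iid (I - \<phi> ` N) M)"
      by simp
    also have "(\<integral>z. u (merge C D (restrict x C, pull D \<psi> z)) \<partial>iid (I - \<phi> ` N) M) = w x"
      unfolding w_def
      by (rule integral_pull[OF M _ D_sub])
        (use u_int[OF x] \<psi>(1) CD(6) in \<open>auto intro: inj_on_subset borel_measurable_integrable\<close>)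
    finally show ?thesis .
  qed
  have "(\<integral>X. ?F X \<partial>iid I M) = (\<integral>x. rooted M I N \<phi> ?F x \<partial>iid N M)"
    using integral_rooted(1)[OF M fin(1) \<phi> F F_bd] by simp
  also have "\<dots> = (\<integral>x. u x * w x \<partial>iid N M)"
    by (rule Bochner_Integration.integral_cong) (auto simp: rooted)
  \<comment> \<open>Integrating out the private coordinates of the first factor produces the second copy of \<open>w\<close>.\<close>
  also have "\<dots> = (\<integral>x. (\<integral>y. u (merge C D (x, y)) * w (merge C D (x, y)) \<partial>iid D M) \<partial>iid C M)"
  proof -
    have "integrable (iid N M) (\<lambda>x. u x * w x)"
    proof (rule N.integrable_const_bound[of _ "B * B"])
      show "AE x in iid N M. norm (u x * w x) \<le> B * B"
        unfolding real_norm_def abs_mult by (intro AE_I2 mult_mono u(2) w_bd B0) simp_all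
    qed (use w_meas u in measurable)
    then show ?thesis
      using product_integral_fold[OF CD(2-4)] unfolding CD(1) by blast
  qed
  also have "\<dots> = (\<integral>x. w x * w x \<partial>iid C M)"
  proof (rule Bochner_Integration.integral_cong[OF refl])
    fix x assume x: "x \<in> space (iid C M)"
    have "restrict x C = x" using x by (simp add: space_PiM PiE_restrict)
    moreover have "restrict (merge C D (x, y)) C = x" for y
      using x by (auto simp: space_PiM PiE_def extensional_def merge_def fun_eq_iff)
    ultimately have "w (merge C D (x, y)) = w x" "w x = (\<integral>y. u (merge C D (x, y)) \<partial>iid D M)" for y
      by (simp_all add: w_def)
    then show "(\<integral>y. u (merge C D (x, y)) * w (merge C D (x, y)) \<partial>iid D M) = w x * w x"
      by simp
  qed
  also have "0 \<le> \<dots>" by (intro Bochner_Integration.integral_nonneg) simp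
  finally show ?thesis .
qed

section \<open>Kernels evaluated along symmetric copies\<close>

text \<open>With \<open>s = ln \<Phi>\<close> this is the pointwise inequality, including its equality case, behind the
nonnegativity of the symmetrised relative entropy of \<open>\<Phi> / t\<close>.\<close>

lemma exp_minus_times_minus_ln:
  fixes s t :: real
  assumes "0 < t"
  shows "0 \<le> (exp s - t) * (s - ln t)" "(exp s - t) * (s - ln t) = 0 \<Longrightarrow> s = ln t"
proof -
  have "exp s \<le> t \<longleftrightarrow> s \<le> ln t" "exp s = t \<longleftrightarrow> s = ln t"
    using assms by (metis exp_le_cancel_iff exp_ln, metis exp_ln ln_exp)
  then show "0 \<le> (exp s - t) * (s - ln t)" "(exp s - t) * (s - ln t) = 0 \<Longrightarrow> s = ln t"
    by (auto simp: zero_le_mult_iff)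
qed

text \<open>Completeness makes \<open>f\<close> measurable with respect to the completion, being almost everywhere equal
to \<open>g\<close>.  This applies to products of Lebesgue measurable kernels, whose measurability on the larger cube
is not evident.\<close>

lemma integral_completion_cong_AE:
  fixes f g :: "'b \<Rightarrow> real"
  assumes eq: "AE x in L. f x = g x" and g: "g \<in> borel_measurable L"
  shows "(\<integral>x. f x \<partial>completion L) = (\<integral>x. g x \<partial>L)"
proof -
  have g': "g \<in> borel_measurable (completion L)" using g by (rule measurable_completion)
  have eq': "AE x in completion L. f x = g x" using eq by (rule AE_completion)
  have "f \<in> borel_measurable (completion L)"
  proof (rule measurableI)
    fix A :: "real set" assume A: "A \<in> sets borel"
    show "f -` A \<inter> space (completion L) \<in> sets (completion L)"
    proof (rule completion.in_sets_AE)
      show "g -` A \<inter> space (completion L) \<in> sets (completion L)"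
        by (rule measurable_sets[OF g' A])
      show "AE x in completion L. (x \<in> g -` A \<inter> space (completion L)) = (x \<in> f -` A \<inter> space (completion L))"
        using eq' by eventually_elim simp
    qed simp
  qed simp
  then have "(\<integral>x. f x \<partial>completion L) = (\<integral>x. g x \<partial>completion L)"
    using g' eq' by (intro integral_cong_AE)
  then show ?thesis using integral_completion[OF g] by simp
qed

text \<open>The index \<open>e\<close> is an edge, and \<open>\<phi> e\<close> sends a coordinate of the kernel to the variable that is
inserted there.\<close>

locale symmetric_copies = prob_space M
  for M :: "'a measure" +
  fixes I :: "'i set" and N :: "'n set" and E :: "'e set" and \<phi> :: "'e \<Rightarrow> 'n \<Rightarrow> 'i"
  assumes finite: "finite I" "finite N" "finite E"
    and nonempty: "E \<noteq> {}"
    and inj: "e \<in> E \<Longrightarrow> inj_on (\<phi> e) N"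
    and sub: "e \<in> E \<Longrightarrow> \<phi> e ` N \<subseteq> I"
begin

text \<open>Invariance under all permutations of \<open>N\<close> would be too much to ask: the coordinates of a
hypergraphon are indexed by faces, and only permutations of faces that come from permutations of
vertices are required to preserve it.  What is needed is that for each pair of copies some
reordering of the second makes it agree with the first on the shared variables.\<close>

definition overlap_symmetric :: "(('n \<Rightarrow> 'a) \<Rightarrow> real) \<Rightarrow> bool" where
  "overlap_symmetric K \<longleftrightarrow> (\<forall>e\<in>E. \<forall>f\<in>E. \<exists>\<sigma>. \<sigma> permutes N \<and>
     (\<forall>i\<in>N. \<phi> e i \<in> \<phi> f ` N \<longrightarrow> \<phi> f (\<sigma> i) = \<phi> e i) \<and>
     (AE x in iid N M. K (pull N \<sigma> x) = K x))"

definition integrand :: "(('n \<Rightarrow> 'a) \<Rightarrow> real) \<Rightarrow> ('i \<Rightarrow> 'a) \<Rightarrow> real" where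
  "integrand K X = (\<Prod>e\<in>E. K (pull N (\<phi> e) X))"

text \<open>Pairwise correlations of copies are nonnegative, so the correlation of the zero sum with a single
copy can vanish only if the second moment of that copy does.\<close>

lemma copies_sum_zero:
  assumes u: "u \<in> borel_measurable (iid N M)" "\<And>x. \<bar>u x\<bar> \<le> B"
    and sym: "overlap_symmetric u"
    and zero: "AE X in iid I M. (\<Sum>e\<in>E. u (pull N (\<phi> e) X)) = 0"
  shows "AE x in iid N M. u x = 0"
proof -
  interpret I: prob_space "iid I M" by (rule prob_space_iid) (rule prob_space_axioms)
  interpret N: prob_space "iid N M" by (rule prob_space_iid) (rule prob_space_axioms)
  note M = prob_space_axioms
  obtain e where e: "e \<in> E" using nonempty by auto
  have B0: "0 \<le> B" using u(2)[of undefined] by linarith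
  have um: "(\<lambda>X. u (pull N (\<phi> f) X)) \<in> borel_measurable (iid I M)" if "f \<in> E" for f
    using measurable_compose[OF measurable_pull[OF sub[OF that]] u(1)] .
  have int: "integrable (iid I M) (\<lambda>X. u (pull N (\<phi> e) X) * u (pull N (\<phi> f) X))" if "f \<in> E" for f
  proof (rule integrable_bounded[OF I.prob_space_axioms])
    show "(\<lambda>X. u (pull N (\<phi> e) X) * u (pull N (\<phi> f) X)) \<in> borel_measurable (iid I M)"
      by (intro borel_measurable_times um that e)
    show "\<bar>u (pull N (\<phi> e) X) * u (pull N (\<phi> f) X)\<bar> \<le> B * B" for X
      unfolding abs_mult by (intro mult_mono u(2) B0) simp
  qed
  have nonneg: "0 \<le> (\<integral>X. u (pull N (\<phi> e) X) * u (pull N (\<phi> f) X) \<partial>iid I M)" if f: "f \<in> E" for f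
  proof -
    obtain \<sigma> where \<sigma>: "\<sigma> permutes N" "\<And>i. i \<in> N \<Longrightarrow> \<phi> e i \<in> \<phi> f ` N \<Longrightarrow> \<phi> f (\<sigma> i) = \<phi> e i"
        and inv: "AE x in iid N M. u (pull N \<sigma> x) = u x"
      using sym[unfolded overlap_symmetric_def, rule_format, OF e f] by auto
    have im: "\<sigma> ` N = N" using \<sigma>(1) by (rule permutes_image)
    have im': "(\<phi> f \<circ> \<sigma>) ` N = \<phi> f ` N" unfolding image_comp[symmetric] im ..
    have inj': "inj_on (\<phi> f \<circ> \<sigma>) N"
      by (rule comp_inj_on) (simp_all add: permutes_inj_on[OF \<sigma>(1)] im inj f)
    have sub': "(\<phi> f \<circ> \<sigma>) ` N \<subseteq> I" unfolding im' by (rule sub[OF f])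
    have agree: "(\<phi> f \<circ> \<sigma>) i = \<phi> e i" if "i \<in> N" "\<phi> e i \<in> (\<phi> f \<circ> \<sigma>) ` N" for i
      unfolding comp_def using that(2) unfolding im' by (rule \<sigma>(2)[OF that(1)])
    have "AE X in iid I M. u (pull N \<sigma> (pull N (\<phi> f) X)) = u (pull N (\<phi> f) X)"
      by (rule AE_pull[OF M inj[OF f] sub[OF f] inv])
    then have "AE X in iid I M. u (pull N (\<phi> f \<circ> \<sigma>) X) = u (pull N (\<phi> f) X)"
      by (simp add: pull_pull im)
    then have "(\<integral>X. u (pull N (\<phi> e) X) * u (pull N (\<phi> f) X) \<partial>iid I M)
        = (\<integral>X. u (pull N (\<phi> e) X) * u (pull N (\<phi> f \<circ> \<sigma>) X) \<partial>iid I M)"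
      using um[OF e] um[OF f] measurable_compose[OF measurable_pull[OF sub'] u(1)]
      by (intro integral_cong_AE borel_measurable_times) auto
    also have "0 \<le> \<dots>"
      by (rule correlation_nonneg[OF M finite(1,2) inj[OF e] sub[OF e] inj' sub' agree u])
    finally show ?thesis .
  qed
  have "(\<Sum>f\<in>E. \<integral>X. u (pull N (\<phi> e) X) * u (pull N (\<phi> f) X) \<partial>iid I M)
      = (\<integral>X. u (pull N (\<phi> e) X) * (\<Sum>f\<in>E. u (pull N (\<phi> f) X)) \<partial>iid I M)"
    unfolding sum_distrib_left by (rule Bochner_Integration.integral_sum[symmetric]) (rule int)
  also have "\<dots> = 0"
  proof (rule integral_eq_zero_AE)
    show "AE X in iid I M. u (pull N (\<phi> e) X) * (\<Sum>f\<in>E. u (pull N (\<phi> f) X)) = 0"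
      using zero by eventually_elim simp
  qed
  finally have "(\<integral>X. u (pull N (\<phi> e) X) * u (pull N (\<phi> e) X) \<partial>iid I M) = 0"
    using e nonneg finite(3) by (simp add: sum_nonneg_eq_0_iff)
  then have "(\<integral>x. u x * u x \<partial>iid N M) = 0"
    using integral_pull[OF M inj[OF e] sub[OF e] borel_measurable_times[OF u(1) u(1)]] by simp
  moreover have "integrable (iid N M) (\<lambda>x. u x * u x)"
  proof (rule integrable_bounded[OF N.prob_space_axioms borel_measurable_times[OF u(1) u(1)]])
    show "\<bar>u x * u x\<bar> \<le> B * B" for x
      unfolding abs_mult by (intro mult_mono u(2) B0) simp
  qed
  ultimately have "AE x in iid N M. u x * u x = 0"
    by (subst (asm) integral_nonneg_eq_0_iff_AE) auto
  then show ?thesis by simp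
qed

lemma integrand_measurable:
  assumes "K \<in> borel_measurable (iid N M)"
  shows "integrand K \<in> borel_measurable (iid I M)"
  unfolding integrand_def[abs_def]
  by (intro borel_measurable_prod measurable_compose[OF measurable_pull[OF sub] assms])

lemma integrand_bounds:
  assumes "\<And>x. 0 \<le> K x" "\<And>x. K x \<le> 1"
  shows "0 \<le> integrand K X" "integrand K X \<le> 1"
  unfolding integrand_def using assms by (auto intro: prod_nonneg prod_le_1)

text \<open>If the rooted density at \<open>e\<close> is constant, then reweighting by the integrand leaves the law of the
variables seen by \<open>e\<close> unchanged up to the factor \<open>c\<close>.\<close>

lemma weighted_integral:
  assumes K: "K \<in> borel_measurable (iid N M)" "\<And>x. 0 \<le> K x" "\<And>x. K x \<le> 1"
    and e: "e \<in> E"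
    and const: "AE x in iid N M. rooted M I N (\<phi> e) (integrand K) x = c"
    and h: "h \<in> borel_measurable (iid N M)" "\<And>x. \<bar>h x\<bar> \<le> B"
  shows "(\<integral>X. integrand K X * h (pull N (\<phi> e) X) \<partial>iid I M) = c * (\<integral>x. h x \<partial>iid N M)"
proof -
  note M = prob_space_axioms
  note m = integrand_measurable[OF K(1)]
  let ?\<Phi> = "\<lambda>X. integrand K X * h (pull N (\<phi> e) X)"
  have bd: "\<bar>integrand K X\<bar> \<le> 1" for X
    using integrand_bounds[of K X] K(2,3) by simp
  have \<Phi>: "?\<Phi> \<in> borel_measurable (iid I M)"
    by (intro borel_measurable_times m measurable_compose[OF measurable_pull[OF sub[OF e]] h(1)])
  have \<Phi>_bd: "\<bar>?\<Phi> X\<bar> \<le> 1 * B" for X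
    unfolding abs_mult by (intro mult_mono bd h(2)) simp_all
  note R = integral_rooted[OF M finite(1) inj[OF e] sub[OF e]]
  have eq: "rooted M I N (\<phi> e) ?\<Phi> x = rooted M I N (\<phi> e) (integrand K) x * h x"
    if "x \<in> space (iid N M)" for x
    unfolding rooted_def by (simp add: pull_glue[OF inj[OF e] that])
  have "(\<integral>X. ?\<Phi> X \<partial>iid I M) = (\<integral>x. rooted M I N (\<phi> e) ?\<Phi> x \<partial>iid N M)"
    by (rule R(1)[symmetric, OF \<Phi> \<Phi>_bd])
  also have "\<dots> = (\<integral>x. c * h x \<partial>iid N M)"
  proof (rule integral_cong_AE)
    show "AE x in iid N M. rooted M I N (\<phi> e) ?\<Phi> x = c * h x"
      using const AE_space by eventually_elim (simp add: eq)
  qed (use R(2)[OF \<Phi> \<Phi>_bd] h(1) in auto)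
  finally show ?thesis by simp
qed

text \<open>The rooted density at \<open>e\<close> contains the factor \<open>K x\<close>, and all other factors are at most \<open>1\<close>.\<close>

lemma kernel_bounded_below:
  assumes K: "K \<in> borel_measurable (iid N M)" "\<And>x. 0 \<le> K x" "\<And>x. K x \<le> 1"
    and e: "e \<in> E"
    and const: "AE x in iid N M. rooted M I N (\<phi> e) (integrand K) x = c"
  shows "AE x in iid N M. c \<le> K x"
  using const AE_space
proof eventually_elim
  case (elim x)
  interpret P: prob_space "iid (I - \<phi> e ` N) M" by (rule prob_space_iid) (rule prob_space_axioms)
  have le: "integrand K (glue I N (\<phi> e) x z) \<le> K x" for z
  proof -
    have "integrand K (glue I N (\<phi> e) x z)
        = K x * (\<Prod>f\<in>E - {e}. K (pull N (\<phi> f) (glue I N (\<phi> e) x z)))"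
      unfolding integrand_def using e finite(3) elim(2)
      by (subst prod.remove[of _ e]) (simp_all add: pull_glue inj)
    also have "\<dots> \<le> K x * 1"
      by (intro mult_left_mono prod_le_1) (auto simp: K)
    finally show ?thesis by simp
  qed
  have "rooted M I N (\<phi> e) (integrand K) x \<le> (\<integral>z. K x \<partial>iid (I - \<phi> e ` N) M)"
    unfolding rooted_def
  proof (rule integral_mono)
    have "(\<lambda>z. integrand K (glue I N (\<phi> e) x z)) \<in> borel_measurable (iid (I - \<phi> e ` N) M)"
      using measurable_compose[OF measurable_Pair1'[OF elim(2)]
        measurable_compose[OF measurable_glue[OF sub[OF e]] integrand_measurable[OF K(1)]]] by simp
    then show "integrable (iid (I - \<phi> e ` N) M) (\<lambda>z. integrand K (glue I N (\<phi> e) x z))"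
      by (rule integrable_bounded[OF P.prob_space_axioms, of _ 1])
        (use integrand_bounds[of K] K in simp)
  qed (auto intro: le)
  then show ?case using elim(1) by (simp add: P.prob_space)
qed

text \<open>The entropy argument shows that the integrand equals \<open>t\<close> almost everywhere, and \<open>copies_sum_zero\<close>,
applied to the centred logarithm of the kernel, passes from the product to its factors.\<close>

lemma rigidity:
  assumes K: "K \<in> borel_measurable (iid N M)" "\<And>x. 0 \<le> K x" "\<And>x. K x \<le> 1"
    and sym: "overlap_symmetric K"
    and const: "\<And>e. e \<in> E \<Longrightarrow> \<exists>c. AE x in iid N M. rooted M I N (\<phi> e) (integrand K) x = c"
  defines "t \<equiv> \<integral>X. integrand K X \<partial>iid I M"
  shows "t = 0 \<or> (AE x in iid N M. K x = t powr (1 / real (card E)))"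
proof (cases "t = 0")
  case False
  interpret I: prob_space "iid I M" by (rule prob_space_iid) (rule prob_space_axioms)
  interpret N: prob_space "iid N M" by (rule prob_space_iid) (rule prob_space_axioms)
  note M = prob_space_axioms
  have t: "0 < t" "t \<le> 1"
  proof -
    have "integrable (iid I M) (integrand K)"
      by (rule integrable_bounded[OF I.prob_space_axioms, of _ 1])
        (use integrand_bounds[of K] K integrand_measurable in auto)
    then have "t \<le> (\<integral>X. 1 \<partial>iid I M)"
      unfolding t_def by (intro integral_mono) (use integrand_bounds[of K] K in auto)
    then show "t \<le> 1" by (simp add: I.prob_space)
    have "0 \<le> t" unfolding t_def
      by (intro Bochner_Integration.integral_nonneg) (use integrand_bounds[of K] K in auto)
    with False show "0 < t" by simp
  qed
  have root: "AE x in iid N M. rooted M I N (\<phi> e) (integrand K) x = t" if e: "e \<in> E" for e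
  proof -
    obtain c where c: "AE x in iid N M. rooted M I N (\<phi> e) (integrand K) x = c"
      using const[OF e] by blast
    have "t = c" using weighted_integral[OF K e c, of "\<lambda>_. 1" 1] by (simp add: t_def N.prob_space)
    with c show ?thesis by simp
  qed
  obtain e\<^sub>0 where "e\<^sub>0 \<in> E" using nonempty by auto
  with kernel_bounded_below[OF K _ root] have Kt: "AE x in iid N M. t \<le> K x" by blast
  \<comment> \<open>The truncation at \<open>t\<close> changes \<open>K\<close> on a null set only and makes the logarithm bounded everywhere.\<close>
  define l where "l x = ln (max t (K x))" for x
  have l_bd: "\<bar>l x\<bar> \<le> \<bar>ln t\<bar>" for x
  proof -
    have "ln t \<le> l x" "l x \<le> ln 1"
      using t K(3)[of x] unfolding l_def by (simp_all del: ln_one)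
    then show ?thesis by simp
  qed
  have l_meas: "l \<in> borel_measurable (iid N M)"
    unfolding l_def[abs_def] by (intro borel_measurable_ln borel_measurable_max K(1)) auto
  have exp_l: "AE x in iid N M. exp (l x) = K x"
    using Kt
  proof eventually_elim
    case (elim x)
    then have "max t (K x) = K x" "0 < K x" using t by auto
    then show ?case by (simp add: l_def)
  qed
  define b where "b = (\<integral>x. l x \<partial>iid N M)"
  define S where "S X = (\<Sum>e\<in>E. l (pull N (\<phi> e) X))" for X
  have lpm: "(\<lambda>X. l (pull N (\<phi> e) X)) \<in> borel_measurable (iid I M)" if "e \<in> E" for e
    using measurable_compose[OF measurable_pull[OF sub[OF that]] l_meas] .
  have S_meas: "S \<in> borel_measurable (iid I M)"
    unfolding S_def[abs_def] by (intro borel_measurable_sum lpm)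
  have Phi_S: "AE X in iid I M. integrand K X = exp (S X)"
  proof -
    have "AE X in iid I M. \<forall>e\<in>E. exp (l (pull N (\<phi> e) X)) = K (pull N (\<phi> e) X)"
      by (rule AE_finite_allI[OF finite(3)]) (rule AE_pull[OF M inj sub exp_l])
    then show ?thesis
      by eventually_elim (simp add: S_def integrand_def exp_sum finite)
  qed
  note [measurable] = integrand_measurable[OF K(1)] S_meas
  have int_l: "integrable (iid I M) (\<lambda>X. l (pull N (\<phi> e) X))" if "e \<in> E" for e
    by (rule integrable_bounded[OF I.prob_space_axioms lpm[OF that] l_bd])
  have int_Kl: "integrable (iid I M) (\<lambda>X. integrand K X * l (pull N (\<phi> e) X))" if "e \<in> E" for e
  proof (rule integrable_bounded[OF I.prob_space_axioms])
    show "(\<lambda>X. integrand K X * l (pull N (\<phi> e) X)) \<in> borel_measurable (iid I M)"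
      by (intro borel_measurable_times integrand_measurable K(1) lpm that)
    have "\<bar>integrand K X\<bar> \<le> 1" for X using integrand_bounds[of K X] K by simp
    then show "\<bar>integrand K X * l (pull N (\<phi> e) X)\<bar> \<le> 1 * \<bar>ln t\<bar>" for X
      unfolding abs_mult by (intro mult_mono l_bd) simp_all
  qed
  have int_K: "integrable (iid I M) (integrand K)"
    by (rule integrable_bounded[OF I.prob_space_axioms, of _ 1])
      (use integrand_bounds[of K] K integrand_measurable in auto)
  have m: "0 < real (card E)" using finite nonempty by (simp add: card_gt_0_iff)
  have int_S: "integrable (iid I M) S" and ES: "(\<integral>X. S X \<partial>iid I M) = card E * b"
  proof -
    show "integrable (iid I M) S"
      unfolding S_def[abs_def] by (intro Bochner_Integration.integrable_sum int_l)
    have "(\<integral>X. S X \<partial>iid I M) = (\<Sum>e\<in>E. \<integral>X. l (pull N (\<phi> e) X) \<partial>iid I M)"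
      unfolding S_def by (rule Bochner_Integration.integral_sum) (rule int_l)
    also have "\<dots> = (\<Sum>e\<in>E. b)"
      unfolding b_def by (intro sum.cong refl integral_pull[OF M inj sub l_meas])
    finally show "(\<integral>X. S X \<partial>iid I M) = card E * b" by simp
  qed
  have int_KS: "integrable (iid I M) (\<lambda>X. integrand K X * S X)"
    and EKS: "(\<integral>X. integrand K X * S X \<partial>iid I M) = card E * (t * b)"
  proof -
    show "integrable (iid I M) (\<lambda>X. integrand K X * S X)"
      unfolding S_def sum_distrib_left by (intro Bochner_Integration.integrable_sum int_Kl)
    have "(\<integral>X. integrand K X * S X \<partial>iid I M)
        = (\<Sum>e\<in>E. \<integral>X. integrand K X * l (pull N (\<phi> e) X) \<partial>iid I M)"
      unfolding S_def sum_distrib_left by (rule Bochner_Integration.integral_sum) (rule int_Kl)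
    also have "\<dots> = (\<Sum>e\<in>E. t * b)"
      unfolding b_def by (intro sum.cong refl weighted_integral[OF K _ root l_meas l_bd])
    finally show "(\<integral>X. integrand K X * S X \<partial>iid I M) = card E * (t * b)" by simp
  qed
  let ?D = "\<lambda>X. (integrand K X - t) * (S X - ln t)"
  have D_expand: "?D X = integrand K X * S X - t * S X - ln t * integrand K X + t * ln t" for X
    by (simp add: algebra_simps)
  have "(\<integral>X. ?D X \<partial>iid I M) = card E * (t * b) - t * (card E * b) - ln t * t + t * ln t"
    unfolding D_expand using int_S int_KS int_K
    by (simp add: EKS ES t_def[symmetric] I.prob_space)
  then have D0: "(\<integral>X. ?D X \<partial>iid I M) = 0" by simp
  have "integrable (iid I M) ?D"
    unfolding D_expand using int_S int_KS int_K by simp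
  moreover have "AE X in iid I M. 0 \<le> ?D X"
    using Phi_S by eventually_elim (simp add: exp_minus_times_minus_ln(1)[OF t(1)])
  ultimately have "AE X in iid I M. ?D X = 0"
    using D0 integral_nonneg_eq_0_iff_AE by blast
  then have S_const: "AE X in iid I M. S X = ln t"
    using Phi_S
    by eventually_elim (rule exp_minus_times_minus_ln(2)[OF t(1)], simp)
  have b: "card E * b = ln t"
  proof -
    have "(\<integral>X. S X \<partial>iid I M) = (\<integral>X. ln t \<partial>iid I M)"
      by (rule integral_cong_AE) (use S_const in auto)
    then show ?thesis by (simp add: ES I.prob_space)
  qed
  have "AE x in iid N M. l x - b = 0"
  proof (rule copies_sum_zero)
    show "(\<lambda>x. l x - b) \<in> borel_measurable (iid N M)" using l_meas by simp
    show "\<bar>l x - b\<bar> \<le> \<bar>ln t\<bar> + \<bar>b\<bar>" for x using l_bd[of x] by linarith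
    show "AE X in iid I M. (\<Sum>e\<in>E. l (pull N (\<phi> e) X) - b) = 0"
      using S_const by eventually_elim (simp add: sum_subtractf b S_def)
    show "overlap_symmetric (\<lambda>x. l x - b)"
      unfolding overlap_symmetric_def
    proof (intro ballI)
      fix e f assume "e \<in> E" "f \<in> E"
      then obtain \<sigma> where "\<sigma> permutes N" "\<forall>i\<in>N. \<phi> e i \<in> \<phi> f ` N \<longrightarrow> \<phi> f (\<sigma> i) = \<phi> e i"
          "AE x in iid N M. K (pull N \<sigma> x) = K x"
        using sym unfolding overlap_symmetric_def by blast
      moreover from this(3) have "AE x in iid N M. l (pull N \<sigma> x) - b = l x - b"
        by eventually_elim (simp add: l_def)
      ultimately show "\<exists>\<sigma>. \<sigma> permutes N \<and> (\<forall>i\<in>N. \<phi> e i \<in> \<phi> f ` N \<longrightarrow> \<phi> f (\<sigma> i) = \<phi> e i) \<and>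
          (AE x in iid N M. l (pull N \<sigma> x) - b = l x - b)" by blast
    qed
  qed
  with exp_l have "AE x in iid N M. K x = t powr (1 / real (card E))"
  proof eventually_elim
    case (elim x)
    have "b = (1 / real (card E)) * ln t" using b m by (simp add: field_simps)
    then show ?case using elim t by (simp add: powr_def)
  qed
  then show ?thesis ..
qed simp


text \<open>A Borel measurable version of the kernel has the same density, and almost everywhere the same
rooted densities, because every copy map is measure preserving.\<close>

lemma rigidity_completion:
  assumes K: "K \<in> borel_measurable (completion (iid N M))" "\<forall>x\<in>space (iid N M). 0 \<le> K x \<and> K x \<le> 1"
    and sym: "overlap_symmetric K"
    and const: "\<And>e. e \<in> E \<Longrightarrow> \<exists>c. AE x in completion (iid N M).
      (\<integral>z. integrand K (glue I N (\<phi> e) x z) \<partial>completion (iid (I - \<phi> e ` N) M)) = c"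
  defines "t \<equiv> \<integral>X. integrand K X \<partial>completion (iid I M)"
  shows "t = 0 \<or> (AE x in completion (iid N M). K x = t powr (1 / real (card E)))"
proof -
  note M = prob_space_axioms
  obtain K\<^sub>0 where K\<^sub>0: "K\<^sub>0 \<in> borel_measurable (iid N M)" "AE x in iid N M. K x = K\<^sub>0 x"
    using completion_ex_borel_measurable_real[OF K(1)] by blast
  define L where "L x = max 0 (min 1 (K\<^sub>0 x))" for x
  have L: "L \<in> borel_measurable (iid N M)" "\<And>x. 0 \<le> L x" "\<And>x. L x \<le> 1"
    using K\<^sub>0(1) by (auto simp: L_def[abs_def])
  have KL: "AE x in iid N M. K x = L x"
    using K\<^sub>0(2) AE_space
  proof eventually_elim
    case (elim x)
    then show ?case using K(2) by (auto simp: L_def)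
  qed
  have int_KL: "AE X in iid I M. integrand K X = integrand L X"
  proof -
    have "AE X in iid I M. \<forall>e\<in>E. K (pull N (\<phi> e) X) = L (pull N (\<phi> e) X)"
      by (rule AE_finite_allI[OF finite(3)]) (rule AE_pull[OF M inj sub KL])
    then show ?thesis by eventually_elim (simp add: integrand_def)
  qed
  have t: "t = (\<integral>X. integrand L X \<partial>iid I M)"
    unfolding t_def by (rule integral_completion_cong_AE[OF int_KL integrand_measurable[OF L(1)]])
  have "(\<integral>X. integrand L X \<partial>iid I M) = 0 \<or>
      (AE x in iid N M. L x = (\<integral>X. integrand L X \<partial>iid I M) powr (1 / real (card E)))"
  proof (rule rigidity[OF L])
    show "overlap_symmetric L"
      unfolding overlap_symmetric_def
    proof (intro ballI)
      fix e f assume "e \<in> E" "f \<in> E"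
      then obtain \<sigma> where \<sigma>: "\<sigma> permutes N" "\<forall>i\<in>N. \<phi> e i \<in> \<phi> f ` N \<longrightarrow> \<phi> f (\<sigma> i) = \<phi> e i"
          "AE x in iid N M. K (pull N \<sigma> x) = K x"
        using sym unfolding overlap_symmetric_def by blast
      have "AE x in iid N M. K (pull N \<sigma> x) = L (pull N \<sigma> x)"
        by (rule AE_pull[OF M permutes_inj_on[OF \<sigma>(1)] _ KL]) (simp add: permutes_image[OF \<sigma>(1)])
      then have "AE x in iid N M. L (pull N \<sigma> x) = L x"
        using KL \<sigma>(3) by eventually_elim simp
      then show "\<exists>\<sigma>. \<sigma> permutes N \<and> (\<forall>i\<in>N. \<phi> e i \<in> \<phi> f ` N \<longrightarrow> \<phi> f (\<sigma> i) = \<phi> e i) \<and>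
          (AE x in iid N M. L (pull N \<sigma> x) = L x)"
        using \<sigma> by blast
    qed
  next
    fix e assume e: "e \<in> E"
    obtain c where "AE x in completion (iid N M).
        (\<integral>z. integrand K (glue I N (\<phi> e) x z) \<partial>completion (iid (I - \<phi> e ` N) M)) = c"
      using const[OF e] by blast
    then have c: "AE x in iid N M.
        (\<integral>z. integrand K (glue I N (\<phi> e) x z) \<partial>completion (iid (I - \<phi> e ` N) M)) = c"
      by (simp add: AE_completion_iff)
    have "AE x in iid N M. rooted M I N (\<phi> e) (integrand L) x = c"
      using AE_glue[OF M finite(1) inj[OF e] sub[OF e] int_KL] c AE_space
    proof eventually_elim
      case (elim x)
      have "(\<lambda>z. integrand L (glue I N (\<phi> e) x z)) \<in> borel_measurable (iid (I - \<phi> e ` N) M)"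
        using measurable_compose[OF measurable_Pair1'[OF elim(3)]
          measurable_compose[OF measurable_glue[OF sub[OF e]] integrand_measurable[OF L(1)]]] by simp
      from integral_completion_cong_AE[OF elim(1) this] elim(2)
      show ?case by (simp add: rooted_def)
    qed
    then show "\<exists>c. AE x in iid N M. rooted M I N (\<phi> e) (integrand L) x = c" ..
  qed
  then show ?thesis
  proof
    assume "AE x in iid N M. L x = (\<integral>X. integrand L X \<partial>iid I M) powr (1 / real (card E))"
    with KL have "AE x in iid N M. K x = t powr (1 / real (card E))"
      by eventually_elim (simp add: t)
    then show ?thesis by (simp add: AE_completion)
  qed (simp add: t)
qed

end

section \<open>Orderings of edges and of their faces\<close>

text \<open>On the indices of shared points \<open>\<sigma>\<close> is forced to be \<open>\<zeta>\<^sup>-\<^sup>1 \<circ> \<eta>\<close>; as this is injective, the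
remaining indices on both sides are equinumerous and may be matched arbitrarily.\<close>

lemma permutation_matching_overlap:
  assumes S: "finite S" and \<eta>: "bij_betw \<eta> S e" and \<zeta>: "bij_betw \<zeta> S f"
  shows "\<exists>\<sigma>. \<sigma> permutes S \<and> (\<forall>i\<in>S. \<eta> i \<in> f \<longrightarrow> \<zeta> (\<sigma> i) = \<eta> i)"
proof -
  define C where "C = {i \<in> S. \<eta> i \<in> f}"
  define g where "g = inv_into S \<zeta> \<circ> \<eta>"
  have "inj_on g C"
    unfolding g_def
  proof (rule comp_inj_on)
    show "inj_on \<eta> C" using \<eta> by (auto simp: bij_betw_def C_def intro: inj_on_subset)
    show "inj_on (inv_into S \<zeta>) (\<eta> ` C)"
      by (rule inj_on_inv_into) (use \<zeta> in \<open>auto simp: bij_betw_def C_def\<close>)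
  qed
  moreover have gC: "g ` C \<subseteq> S"
    using \<zeta> by (auto simp: g_def C_def bij_betw_def intro: inv_into_into)
  ultimately have bij_g: "bij_betw g C (g ` C)" and "card (S - C) = card (S - g ` C)"
    using S by (auto simp: bij_betw_def C_def card_Diff_subset finite_subset card_image)
  then obtain h where h: "bij_betw h (S - C) (S - g ` C)"
    using S finite_same_card_bij[of "S - C" "S - g ` C"] by auto
  define \<sigma> where "\<sigma> i = (if i \<in> C then g i else if i \<in> S then h i else i)" for i
  have "bij_betw \<sigma> C (g ` C)" "bij_betw \<sigma> (S - C) (S - g ` C)"
    using bij_g h bij_betw_cong[of C \<sigma> g] bij_betw_cong[of "S - C" \<sigma> h] by (simp_all add: \<sigma>_def)
  from bij_betw_combine[OF this] have "bij_betw \<sigma> S S"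
    using gC by (simp add: C_def Un_absorb1 Un_Diff_cancel)
  then have "\<sigma> permutes S"
    by (rule bij_imp_permutes) (auto simp: \<sigma>_def C_def)
  moreover have "\<zeta> (\<sigma> i) = \<eta> i" if "i \<in> S" "\<eta> i \<in> f" for i
    using that \<zeta> by (auto simp: \<sigma>_def C_def g_def bij_betw_def f_inv_into_f)
  ultimately show ?thesis by blast
qed

lemma proper_faces_image:
  assumes "bij_betw \<eta> S e"
  shows "inj_on ((`) \<eta>) (proper_faces S)" "(`) \<eta> ` proper_faces S = proper_faces e"
    and "B \<in> proper_faces e \<Longrightarrow> inv_into (proper_faces S) ((`) \<eta>) B = inv_into S \<eta> ` B"
proof -
  have inj: "inj_on \<eta> S" and e: "e = \<eta> ` S" using assms by (auto simp: bij_betw_def)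
  show inj': "inj_on ((`) \<eta>) (proper_faces S)"
    by (rule inj_on_subset[OF inj_on_image_Pow[OF inj]]) (auto simp: proper_faces_def)
  have fwd: "\<eta> ` A \<in> proper_faces e" if "A \<in> proper_faces S" for A
    using that inj_on_image_eq_iff[OF inj, of A S] by (auto simp: proper_faces_def e)
  have bwd: "inv_into S \<eta> ` B \<in> proper_faces S" "\<eta> ` inv_into S \<eta> ` B = B" if "B \<in> proper_faces e" for B
  proof -
    have B: "B \<noteq> {}" "B \<subset> \<eta> ` S" using that by (auto simp: proper_faces_def e)
    show eq: "\<eta> ` inv_into S \<eta> ` B = B"
      using B by (intro image_inv_into_cancel[OF refl]) auto
    have "inv_into S \<eta> ` B \<subseteq> S" using B by (auto intro: inv_into_into)
    moreover have "inv_into S \<eta> ` B \<noteq> S" using eq B by auto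
    ultimately show "inv_into S \<eta> ` B \<in> proper_faces S" using B by (auto simp: proper_faces_def)
  qed
  show "(`) \<eta> ` proper_faces S = proper_faces e"
    using fwd bwd by (metis image_eqI image_subset_iff subsetI subset_antisym)
  show "inv_into (proper_faces S) ((`) \<eta>) B = inv_into S \<eta> ` B" if "B \<in> proper_faces e"
    by (rule inv_into_f_eq[OF inj' bwd[OF that]])
qed

lemma image_permutes_proper_faces:
  assumes "\<sigma> permutes S"
  shows "(\<lambda>A. if A \<in> proper_faces S then \<sigma> ` A else A) permutes proper_faces S"
proof (rule bij_imp_permutes)
  have "bij_betw ((`) \<sigma>) (proper_faces S) (proper_faces S)"
    using proper_faces_image(1,2)[OF permutes_imp_bij[OF assms]] by (simp add: bij_betw_def)
  then show "bij_betw (\<lambda>A. if A \<in> proper_faces S then \<sigma> ` A else A) (proper_faces S) (proper_faces S)"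
    by (simp cong: bij_betw_cong)
qed simp

section \<open>Hyperkernels and hypergraphons\<close>

lemma prob_space_unit_interval: "prob_space (restrict_space lborel {0..1::real})"
  by (rule prob_space_restrict_space) simp_all

theorem theorem1p2:
  fixes k :: nat and V :: "'v set" and E :: "'v set set" and \<eta> :: "'v set \<Rightarrow> nat \<Rightarrow> 'v"
  assumes "k \<ge> 2"
    and "uniform_hypergraph k V E"
    and "card E \<ge> 1"
    and "edge_orderings k E \<eta>"
  shows "(\<forall>K. hyperkernel k K \<longrightarrow>
            (\<forall>e\<in>E. \<exists>c. AE x in cube {1..k}. kernel_rooted_density k V E \<eta> K e x = c) \<longrightarrow>
            kernel_density k V E \<eta> K = 0 \<or>
            (AE x in cube {1..k}.
               K x = kernel_density k V E \<eta> K powr (1 / real (card E)))) \<and>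
         (\<forall>W. hypergraphon k W \<longrightarrow>
            (\<forall>e\<in>E. \<exists>c. AE x in cube (proper_faces {1..k}).
               graphon_rooted_density k V E \<eta> W e x = c) \<longrightarrow>
            graphon_density k V E \<eta> W = 0 \<or>
            (AE x in cube (proper_faces {1..k}).
               W x = graphon_density k V E \<eta> W powr (1 / real (card E))))"
proof (intro conjI allI impI)
  let ?U = "restrict_space lborel {0..1::real}"
  have edge: "e \<subseteq> V" "card e = k" if "e \<in> E" for e
    using assms(2) that by (auto simp: uniform_hypergraph_def)
  have fin: "finite V" "finite E" "E \<noteq> {}"
    using assms(2,3) by (auto simp: uniform_hypergraph_def intro: card_ge_0_finite)
  have \<eta>: "bij_betw (\<eta> e) {1..k} e" if "e \<in> E" for e
    using assms(4) that by (auto simp: edge_orderings_def)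
  then have \<eta>_image: "\<eta> e ` {1..k} = e" if "e \<in> E" for e
    using that by (auto simp: bij_betw_def)
  {
    fix K
    assume K: "hyperkernel k K"
      and const: "\<forall>e\<in>E. \<exists>c. AE x in cube {1..k}. kernel_rooted_density k V E \<eta> K e x = c"
    interpret symmetric_copies ?U V "{1..k}" E \<eta>
      by (intro symmetric_copies.intro prob_space_unit_interval symmetric_copies_axioms.intro)
        (use fin edge \<eta> \<eta>_image in \<open>auto simp: bij_betw_def\<close>)
    have integrand: "kernel_integrand k E \<eta> K = integrand K"
      unfolding kernel_integrand_def[abs_def] integrand_def[abs_def] pull_def ..
    have rooted: "kernel_rooted_density k V E \<eta> K e x
        = (\<integral>z. integrand K (glue V {1..k} (\<eta> e) x z) \<partial>completion (iid (V - \<eta> e ` {1..k}) ?U))"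
      if "e \<in> E" for e x
      unfolding kernel_rooted_density_def cube_def glue_def pull_def \<eta>_image[OF that] integrand ..
    have root: "\<exists>c. AE x in completion (iid {1..k} ?U).
        (\<integral>z. integrand K (glue V {1..k} (\<eta> e) x z) \<partial>completion (iid (V - \<eta> e ` {1..k}) ?U)) = c"
      if "e \<in> E" for e
      using bspec[OF const that] unfolding rooted[OF that] cube_def .
    have sym: "overlap_symmetric K"
      unfolding overlap_symmetric_def
    proof (intro ballI)
      fix e f assume "e \<in> E" "f \<in> E"
      then obtain \<sigma> where \<sigma>: "\<sigma> permutes {1..k}" "\<forall>i\<in>{1..k}. \<eta> e i \<in> f \<longrightarrow> \<eta> f (\<sigma> i) = \<eta> e i"
        using permutation_matching_overlap[OF _ \<eta> \<eta>] by blast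
      have "AE x in iid {1..k} ?U. K (pull {1..k} \<sigma> x) = K x"
        using K \<sigma>(1) unfolding hyperkernel_def pull_def cube_def by (intro AE_I2) simp
      with \<sigma> show "\<exists>\<sigma>. \<sigma> permutes {1..k} \<and>
          (\<forall>i\<in>{1..k}. \<eta> e i \<in> \<eta> f ` {1..k} \<longrightarrow> \<eta> f (\<sigma> i) = \<eta> e i) \<and>
          (AE x in iid {1..k} ?U. K (pull {1..k} \<sigma> x) = K x)"
        unfolding \<eta>_image[OF \<open>f \<in> E\<close>] by blast
    qed
    have "K \<in> borel_measurable (completion (iid {1..k} ?U))"
      "\<forall>x\<in>space (iid {1..k} ?U). 0 \<le> K x \<and> K x \<le> 1"
      using K unfolding hyperkernel_def cube_def space_completion by blast+
    from rigidity_completion[OF this sym root]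
    show "kernel_density k V E \<eta> K = 0 \<or>
      (AE x in cube {1..k}. K x = kernel_density k V E \<eta> K powr (1 / real (card E)))"
      unfolding kernel_density_def cube_def integrand .
  }
  {
    fix W
    assume W: "hypergraphon k W"
      and const: "\<forall>e\<in>E. \<exists>c. AE x in cube (proper_faces {1..k}).
        graphon_rooted_density k V E \<eta> W e x = c"
    let ?N = "proper_faces {1..k}"
    note faces = proper_faces_image[OF \<eta>]
    interpret symmetric_copies ?U "small_sets k V" ?N E "\<lambda>e. (`) (\<eta> e)"
    proof (intro symmetric_copies.intro prob_space_unit_interval symmetric_copies_axioms.intro)
      show "finite (small_sets k V)"
        by (rule finite_subset[of _ "Pow V"]) (use fin in \<open>auto simp: small_sets_def\<close>)
      show "finite ?N"
        by (rule finite_subset[of _ "Pow {1..k}"]) (auto simp: proper_faces_def)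
      show "(`) (\<eta> e) ` ?N \<subseteq> small_sets k V" if "e \<in> E" for e
      proof -
        have "finite e" using edge(1)[OF that] fin finite_subset by blast
        then show ?thesis
          unfolding faces(2)[OF that] using edge[OF that] psubset_card_mono[of e]
          by (auto simp: proper_faces_def small_sets_def)
      qed
    qed (use fin faces in auto)
    have integrand: "graphon_integrand k E \<eta> W = integrand W"
      unfolding graphon_integrand_def[abs_def] integrand_def[abs_def] pull_def ..
    have rooted: "graphon_rooted_density k V E \<eta> W e x
        = (\<integral>z. integrand W (glue (small_sets k V) ?N ((`) (\<eta> e)) x z)
            \<partial>completion (iid (small_sets k V - (`) (\<eta> e) ` ?N) ?U))"
      if "e \<in> E" for e x
    proof -
      have "(\<lambda>B\<in>proper_faces e. x (inv_into {1..k} (\<eta> e) ` B))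
          = pull (proper_faces e) (inv_into ?N ((`) (\<eta> e))) x"
        unfolding pull_def by (rule restrict_ext) (simp only: faces(3)[OF that])
      then show ?thesis
        unfolding graphon_rooted_density_def cube_def glue_def faces(2)[OF that] integrand by simp
    qed
    have root: "\<exists>c. AE x in completion (iid ?N ?U).
        (\<integral>z. integrand W (glue (small_sets k V) ?N ((`) (\<eta> e)) x z)
          \<partial>completion (iid (small_sets k V - (`) (\<eta> e) ` ?N) ?U)) = c"
      if "e \<in> E" for e
      using bspec[OF const that] unfolding rooted[OF that] cube_def .
    have sym: "overlap_symmetric W"
      unfolding overlap_symmetric_def
    proof (intro ballI)
      fix e f assume "e \<in> E" "f \<in> E"
      then obtain \<sigma> where \<sigma>: "\<sigma> permutes {1..k}" "\<forall>i\<in>{1..k}. \<eta> e i \<in> f \<longrightarrow> \<eta> f (\<sigma> i) = \<eta> e i"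
        using permutation_matching_overlap[OF _ \<eta> \<eta>] by blast
      define \<tau> where "\<tau> A = (if A \<in> ?N then \<sigma> ` A else A)" for A
      have "\<tau> permutes ?N"
        unfolding \<tau>_def by (rule image_permutes_proper_faces[OF \<sigma>(1)])
      moreover have "\<eta> f ` \<tau> A = \<eta> e ` A" if A: "A \<in> ?N" "\<eta> e ` A \<in> (`) (\<eta> f) ` ?N" for A
      proof -
        have "A \<subseteq> {1..k}" "\<eta> e ` A \<subseteq> f"
          using A unfolding faces(2)[OF \<open>f \<in> E\<close>] by (auto simp: proper_faces_def)
        then have "\<eta> f (\<sigma> i) = \<eta> e i" if "i \<in> A" for i
          using \<sigma>(2) that by blast
        then show ?thesis using A by (simp add: \<tau>_def image_image)
      qed
      moreover have "AE x in iid ?N ?U. W (pull ?N \<tau> x) = W x"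
      proof -
        \<comment> \<open>The action moves \<open>A\<close> by the inverse permutation, so invariance is used for \<open>inv \<sigma>\<close>.\<close>
        have "AE x in cube ?N. W (\<lambda>A\<in>?N. x (inv (inv \<sigma>) ` A)) = W x"
          using W permutes_inv[OF \<sigma>(1)] by (auto simp: hypergraphon_def)
        moreover have "(\<lambda>A\<in>?N. x (inv (inv \<sigma>) ` A)) = pull ?N \<tau> x" for x :: "nat set \<Rightarrow> real"
          unfolding pull_def permutes_inv_inv[OF \<sigma>(1)] by (rule restrict_ext) (simp add: \<tau>_def)
        ultimately show ?thesis unfolding cube_def AE_completion_iff by simp
      qed
      ultimately show "\<exists>\<sigma>. \<sigma> permutes ?N \<and>
          (\<forall>i\<in>?N. \<eta> e ` i \<in> (`) (\<eta> f) ` ?N \<longrightarrow> \<eta> f ` \<sigma> i = \<eta> e ` i) \<and>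
          (AE x in iid ?N ?U. W (pull ?N \<sigma> x) = W x)"
        by blast
    qed
    have "W \<in> borel_measurable (completion (iid ?N ?U))"
      "\<forall>x\<in>space (iid ?N ?U). 0 \<le> W x \<and> W x \<le> 1"
      using W unfolding hypergraphon_def cube_def space_completion by blast+
    from rigidity_completion[OF this sym root]
    show "graphon_density k V E \<eta> W = 0 \<or>
      (AE x in cube ?N. W x = graphon_density k V E \<eta> W powr (1 / real (card E)))"
      unfolding graphon_density_def cube_def integrand .
  }
qed

end
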